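(* Let $a<b$ be real numbers and let $f:[a,b]\to\mathbb{R}$ be convex on $[a,b]$. Then $$A_{n+1}\le A_n\quad (n=1,2,\ldots)\qquad\text{and}\qquad B_n\le B_{n+1}\quad (n=2,3,\ldots).$$ Both inequalities are strict if $f$ is strictly convex.
   Context: For $n\ge1$ and $i=0,1,\ldots,n$ put $x_i^{(n)}=a+i\frac{b-a}{n}$. Define $A_n=\frac{b-a}{n+1}\sum_{i=0}^{n}f\bigl(x_i^{(n)}\bigr)$ for $n\ge1$ and $B_n=\frac{b-a}{n-1}\sum_{i=1}^{n-1}f\bigl(x_i^{(n)}\bigr)$ for $n\ge2$. *)

theory Defs
  imports "HOL-Analysis.Analysis"
begin

definition strictly_convex_on :: "'a::real_vector set \<Rightarrow> ('a \<Rightarrow> real) \<Rightarrow> bool"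
  where "strictly_convex_on S f \<longleftrightarrow> convex S \<and>
    (\<forall>x\<in>S. \<forall>y\<in>S. \<forall>u>0. \<forall>v>0. x \<noteq> y \<longrightarrow> u + v = 1 \<longrightarrow>
      f (u *\<^sub>R x + v *\<^sub>R y) < u * f x + v * f y)"

definition grid_point :: "real \<Rightarrow> real \<Rightarrow> nat \<Rightarrow> nat \<Rightarrow> real"
  where "grid_point a b n i = a + real i * ((b - a) / real n)"

text \<open>The following two sequences are only meant for \<open>n \<ge> 1\<close> and \<open>n \<ge> 2\<close>, respectively.\<close>

definition A_seq :: "(real \<Rightarrow> real) \<Rightarrow> real \<Rightarrow> real \<Rightarrow> nat \<Rightarrow> real"
  where "A_seq f a b n = (b - a) / (real n + 1) * (\<Sum>i=0..n. f (grid_point a b n i))"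

definition B_seq :: "(real \<Rightarrow> real) \<Rightarrow> real \<Rightarrow> real \<Rightarrow> nat \<Rightarrow> real"
  where "B_seq f a b n = (b - a) / (real n - 1) * (\<Sum>i=1..n-1. f (grid_point a b n i))"

end

theory Submission
  imports Defs
begin

text \<open>
  The grids for \<open>n\<close> and \<open>n + 1\<close> interlace: each node of one grid is a convex combination, with
  weights linear in the index, of two neighbouring nodes of the other. Applying convexity at every
  node and summing, the weights at each node of the other grid add up to the same constant, which
  is exactly the one needed to compare the two averages.
\<close>

lemma grid_point_mem:
  assumes "a < b" and "i \<le> n" and "0 < n"
  shows "grid_point a b n i \<in> {a..b}"
proof -
  have "real i * ((b - a) / real n) = (real i / real n) * (b - a)"
    by simp
  also have "\<dots> \<le> 1 * (b - a)"
    using assms by (intro mult_right_mono) auto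
  finally show ?thesis
    using assms by (simp add: grid_point_def)
qed

lemma grid_point_less_Suc:
  assumes "a < b" and "0 < n"
  shows "grid_point a b n i < grid_point a b n (Suc i)"
  unfolding grid_point_def using assms by (intro add_strict_left_mono mult_strict_right_mono) auto

text \<open>In units of the coarse step \<open>(b - a) / n\<close>, the fine node
  \<open>Suc i\<close> sits at \<open>(i + 1) * n / (n + 1)\<close>, that is,
  \<open>(i + 1) / (n + 1)\<close> of a step to the left of the coarse node \<open>Suc i\<close>.
  That fraction is the weight of the left neighbour.\<close>

lemma grid_point_Suc_eq:
  assumes "0 < n"
  shows "grid_point a b (Suc n) (Suc i) =
    (real (Suc i) / real (Suc n)) * grid_point a b n i +
    (1 - real (Suc i) / real (Suc n)) * grid_point a b n (Suc i)"
proof -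
  define u h where "u = real (Suc i) / real (Suc n)" and "h = (b - a) / real n"
  have "(b - a) / real (Suc n) = h - h / real (Suc n)"
    using assms by (simp add: h_def divide_simps) algebra
  then have "grid_point a b (Suc n) (Suc i) = a + real (Suc i) * (h - h / real (Suc n))"
    by (simp only: grid_point_def)
  also have "\<dots> = a + (real (Suc i) - u) * h"
    by (simp add: u_def algebra_simps del: of_nat_Suc)
  finally have "grid_point a b (Suc n) (Suc i) = a + (real (Suc i) - u) * h" .
  then show ?thesis
    unfolding u_def[symmetric] grid_point_def h_def[symmetric] by (simp add: algebra_simps)
qed

text \<open>Now the fine step is the unit: the coarse node \<open>i\<close> sits at
  \<open>i * (n + 1) / n\<close>, which is \<open>i / n\<close> of a step to the right of the fine
  node \<open>i\<close>.\<close>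

lemma grid_point_eq_Suc:
  assumes "0 < n"
  shows "grid_point a b n i =
    (1 - real i / real n) * grid_point a b (Suc n) i +
    (real i / real n) * grid_point a b (Suc n) (Suc i)"
proof -
  define u h where "u = real i / real n" and "h = (b - a) / real (Suc n)"
  have "(b - a) / real n = h + h / real n"
    using assms by (simp add: h_def divide_simps) algebra
  then have "grid_point a b n i = a + real i * (h + h / real n)"
    by (simp only: grid_point_def)
  also have "\<dots> = a + (real i + u) * h"
    by (simp add: u_def algebra_simps)
  finally have "grid_point a b n i = a + (real i + u) * h" .
  then show ?thesis
    unfolding u_def[symmetric] grid_point_def h_def[symmetric] by (simp add: algebra_simps)
qed

lemma convex_on_combination:
  fixes f :: "real \<Rightarrow> real"
  assumes "convex_on S f" "x \<in> S" "y \<in> S" "0 \<le> u" "0 \<le> v" "u + v = 1"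
  shows "f (u * x + v * y) \<le> u * f x + v * f y"
  using assms unfolding convex_on_def by simp

lemma strictly_convex_on_combination:
  fixes f :: "real \<Rightarrow> real"
  assumes "strictly_convex_on S f" "x \<in> S" "y \<in> S" "x \<noteq> y" "0 < u" "0 < v" "u + v = 1"
  shows "f (u * x + v * y) < u * f x + v * f y"
  using assms unfolding strictly_convex_on_def by simp

lemma convex_on_grid_point_Suc:
  assumes "a < b" "convex_on {a..b} f" "i < n"
  shows "f (grid_point a b (Suc n) (Suc i)) \<le>
    (real (Suc i) / real (Suc n)) * f (grid_point a b n i) +
    (1 - real (Suc i) / real (Suc n)) * f (grid_point a b n (Suc i))"
proof -
  have "grid_point a b n i \<in> {a..b}" "grid_point a b n (Suc i) \<in> {a..b}"
    using assms by (auto intro!: grid_point_mem simp del: atLeastAtMost_iff)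
  moreover have "0 < n"
    using assms by simp
  ultimately show ?thesis
    unfolding grid_point_Suc_eq[OF \<open>0 < n\<close>]
    using assms by (intro convex_on_combination[OF assms(2)]) auto
qed

text \<open>For \<open>i < n\<close> the weight \<open>(i + 1) / (n + 1)\<close> lies strictly
  between 0 and 1, so every interior fine node yields a strict inequality.\<close>

lemma strictly_convex_on_grid_point_Suc:
  assumes "a < b" "strictly_convex_on {a..b} f" "i < n"
  shows "f (grid_point a b (Suc n) (Suc i)) <
    (real (Suc i) / real (Suc n)) * f (grid_point a b n i) +
    (1 - real (Suc i) / real (Suc n)) * f (grid_point a b n (Suc i))"
proof -
  have "grid_point a b n i \<in> {a..b}" "grid_point a b n (Suc i) \<in> {a..b}"
    using assms by (auto intro!: grid_point_mem simp del: atLeastAtMost_iff)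
  moreover have "0 < n"
    using assms by simp
  moreover have "grid_point a b n i \<noteq> grid_point a b n (Suc i)"
    using grid_point_less_Suc[OF assms(1) \<open>0 < n\<close>, of i] by simp
  ultimately show ?thesis
    unfolding grid_point_Suc_eq[OF \<open>0 < n\<close>]
    using assms by (intro strictly_convex_on_combination[OF assms(2)]) auto
qed

lemma convex_on_grid_point:
  assumes "a < b" "convex_on {a..b} f" "i \<le> n" "0 < n"
  shows "f (grid_point a b n i) \<le>
    (1 - real i / real n) * f (grid_point a b (Suc n) i) +
    (real i / real n) * f (grid_point a b (Suc n) (Suc i))"
proof -
  have "grid_point a b (Suc n) i \<in> {a..b}" "grid_point a b (Suc n) (Suc i) \<in> {a..b}"
    using assms by (auto intro!: grid_point_mem simp del: atLeastAtMost_iff)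
  then show ?thesis
    unfolding grid_point_eq_Suc[OF \<open>0 < n\<close>]
    using assms by (intro convex_on_combination[OF assms(2)]) auto
qed

text \<open>Only interior nodes are strict: at \<open>i = 0\<close> and \<open>i = n\<close> one
  weight vanishes and the two sides agree.\<close>

lemma strictly_convex_on_grid_point:
  assumes "a < b" "strictly_convex_on {a..b} f" "0 < i" "i < n"
  shows "f (grid_point a b n i) <
    (1 - real i / real n) * f (grid_point a b (Suc n) i) +
    (real i / real n) * f (grid_point a b (Suc n) (Suc i))"
proof -
  have "grid_point a b (Suc n) i \<in> {a..b}" "grid_point a b (Suc n) (Suc i) \<in> {a..b}"
    using assms by (auto intro!: grid_point_mem simp del: atLeastAtMost_iff)
  moreover have "grid_point a b (Suc n) i \<noteq> grid_point a b (Suc n) (Suc i)"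
    using grid_point_less_Suc[OF assms(1), of "Suc n" i] by simp
  moreover have "0 < n"
    using assms by simp
  ultimately show ?thesis
    unfolding grid_point_eq_Suc[OF \<open>0 < n\<close>]
    using assms by (intro strictly_convex_on_combination[OF assms(2)]) auto
qed

text \<open>An interior \<open>g j\<close> gets \<open>(j + 1) / (n + 1)\<close> as left neighbour
  and \<open>1 - j / (n + 1)\<close> as right neighbour, in total \<open>(n + 2) / (n + 1)\<close>.
  For positive \<open>n\<close> the sum gives \<open>g 0\<close> and \<open>g n\<close> only
  \<open>1 / (n + 1)\<close> each; the two separate summands supply the missing 1.\<close>

lemma sum_outer_weights:
  fixes g :: "nat \<Rightarrow> real"
  shows "g 0 + (\<Sum>i<n. (real (Suc i) / real (Suc n)) * g i +
      (1 - real (Suc i) / real (Suc n)) * g (Suc i)) + g n =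
    (real n + 2) / (real n + 1) * (\<Sum>i=0..n. g i)"
proof -
  \<comment> \<open>The constant \<open>c\<close> is separated from the upper limit \<open>m\<close>
    so that it stays fixed during the induction; both become \<open>n\<close> afterwards.\<close>
  have "(\<Sum>i<m. real (Suc i) * g i + (c - real i) * g (Suc i)) =
      (c + 2) * (\<Sum>i=0..m. g i) - (c + 1) * g 0 - real (Suc m) * g m" for m c
    by (induction m) (simp_all add: algebra_simps)
  note * = this[of "real n" n]
  have "1 - real (Suc i) / real (Suc n) = (real n - real i) / real (Suc n)" for i
    by (simp add: field_simps)
  then have "(\<Sum>i<n. (real (Suc i) / real (Suc n)) * g i +
      (1 - real (Suc i) / real (Suc n)) * g (Suc i)) =
    (\<Sum>i<n. real (Suc i) * g i + (real n - real i) * g (Suc i)) / real (Suc n)"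
    by (simp add: sum_divide_distrib add_divide_distrib del: of_nat_Suc)
  then show ?thesis
    unfolding * by (simp add: field_simps)
qed

text \<open>Each \<open>g j\<close> gets \<open>1 - j / (n + 1)\<close> from \<open>i = j\<close>
  and \<open>(j - 1) / (n + 1)\<close> from \<open>i = j - 1\<close>, in total
  \<open>n / (n + 1)\<close>. At \<open>j = 1\<close> and \<open>j = n + 1\<close> the absent
  contribution would be zero, so the ends need no correction.\<close>

lemma sum_inner_weights:
  fixes g :: "nat \<Rightarrow> real"
  shows "(\<Sum>i=1..n. (1 - real i / real (Suc n)) * g i + (real i / real (Suc n)) * g (Suc i)) =
    real n / real (Suc n) * (\<Sum>i=1..Suc n. g i)"
proof -
  \<comment> \<open>Again \<open>c\<close> is fixed while \<open>m\<close> grows; the boundary term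
    disappears once \<open>c = Suc m\<close>.\<close>
  have "(\<Sum>i=1..m. (c - real i) * g i + real i * g (Suc i)) =
      (c - 1) * (\<Sum>i=1..Suc m. g i) - (c - real (Suc m)) * g (Suc m)" for m c
    by (induction m) (simp_all add: algebra_simps)
  from this[of "real (Suc n)" n]
  have "(\<Sum>i=1..n. (real (Suc n) - real i) * g i + real i * g (Suc i)) =
      real n * (\<Sum>i=1..Suc n. g i)"
    by simp
  moreover have "1 - real i / real (Suc n) = (real (Suc n) - real i) / real (Suc n)" for i
    by (simp add: field_simps)
  then have "(\<Sum>i=1..n. (1 - real i / real (Suc n)) * g i + (real i / real (Suc n)) * g (Suc i)) =
      (\<Sum>i=1..n. (real (Suc n) - real i) * g i + real i * g (Suc i)) / real (Suc n)"
    by (simp add: sum_divide_distrib add_divide_distrib del: of_nat_Suc)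
  ultimately show ?thesis
    by simp
qed

text \<open>Both grids share their endpoints. Splitting these off leaves the interior fine nodes, in
  the shape required by \<open>sum_outer_weights\<close>.\<close>

lemma sum_grid_Suc:
  fixes f :: "real \<Rightarrow> real"
  assumes "0 < n"
  shows "(\<Sum>i=0..Suc n. f (grid_point a b (Suc n) i)) =
    f (grid_point a b n 0) + (\<Sum>i<n. f (grid_point a b (Suc n) (Suc i))) + f (grid_point a b n n)"
proof -
  have "grid_point a b (Suc n) (Suc n) = grid_point a b n n"
    using assms by (simp add: grid_point_def)
  moreover have "grid_point a b (Suc n) 0 = grid_point a b n 0"
    by (simp add: grid_point_def)
  moreover have "(\<Sum>i=0..Suc n. g i) = g 0 + (\<Sum>i<n. g (Suc i)) + g (Suc n)"
    for g :: "nat \<Rightarrow> real"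
    by (simp only: atLeast0AtMost lessThan_Suc_atMost[symmetric] sum.lessThan_Suc[of _ "Suc n"]
        sum.lessThan_Suc_shift[of _ n])
  ultimately show ?thesis
    by (simp only:)
qed

text \<open>Cancelling the positive prefactor of \<open>A_seq f a b (Suc n)\<close> leaves exactly
  the total weight from \<open>sum_outer_weights\<close>.\<close>

lemma A_seq_less_eq_iff:
  assumes "a < b" and "0 < n"
  shows "A_seq f a b (Suc n) \<le> A_seq f a b n \<longleftrightarrow>
      (\<Sum>i=0..Suc n. f (grid_point a b (Suc n) i)) \<le>
      (real n + 2) / (real n + 1) * (\<Sum>i=0..n. f (grid_point a b n i))" (is ?le)
    and "A_seq f a b (Suc n) < A_seq f a b n \<longleftrightarrow>
      (\<Sum>i=0..Suc n. f (grid_point a b (Suc n) i)) <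
      (real n + 2) / (real n + 1) * (\<Sum>i=0..n. f (grid_point a b n i))" (is ?less)
proof -
  define c where "c = (b - a) / (real n + 2)"
  have c: "0 < c"
    using assms by (simp add: c_def)
  have 1: "A_seq f a b (Suc n) = c * (\<Sum>i=0..Suc n. f (grid_point a b (Suc n) i))"
    unfolding A_seq_def c_def by (simp add: add.commute)
  have 2: "A_seq f a b n =
      c * ((real n + 2) / (real n + 1) * (\<Sum>i=0..n. f (grid_point a b n i)))"
    unfolding A_seq_def c_def by simp
  show ?le ?less
    unfolding 1 2 using c by (simp_all only: mult_le_cancel_left_pos mult_less_cancel_left_pos)
qed

text \<open>Here the prefactor of \<open>B_seq f a b (Suc n)\<close>, which is
  \<open>(b - a) / n\<close>, is cancelled, leaving the total weight from
  \<open>sum_inner_weights\<close>. Starting at \<open>Suc n\<close> avoids subtraction in the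
  indices.\<close>

lemma B_seq_less_eq_iff:
  assumes "a < b" and "0 < n"
  shows "B_seq f a b (Suc n) \<le> B_seq f a b (Suc (Suc n)) \<longleftrightarrow>
      (\<Sum>i=1..n. f (grid_point a b (Suc n) i)) \<le>
      real n / real (Suc n) * (\<Sum>i=1..Suc n. f (grid_point a b (Suc (Suc n)) i))" (is ?le)
    and "B_seq f a b (Suc n) < B_seq f a b (Suc (Suc n)) \<longleftrightarrow>
      (\<Sum>i=1..n. f (grid_point a b (Suc n) i)) <
      real n / real (Suc n) * (\<Sum>i=1..Suc n. f (grid_point a b (Suc (Suc n)) i))" (is ?less)
proof -
  define c where "c = (b - a) / real n"
  have c: "0 < c"
    using assms by (simp add: c_def)
  have 1: "B_seq f a b (Suc n) = c * (\<Sum>i=1..n. f (grid_point a b (Suc n) i))"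
    unfolding B_seq_def c_def by simp
  have 2: "B_seq f a b (Suc (Suc n)) =
      c * (real n / real (Suc n) * (\<Sum>i=1..Suc n. f (grid_point a b (Suc (Suc n)) i)))"
    using assms unfolding B_seq_def c_def by (simp del: sum.cl_ivl_Suc add: add.commute)
  show ?le ?less
    unfolding 1 2 using c by (simp_all only: mult_le_cancel_left_pos mult_less_cancel_left_pos)
qed

lemma A_seq_Suc_le:
  assumes "a < b" and "convex_on {a..b} f" and "0 < n"
  shows "A_seq f a b (Suc n) \<le> A_seq f a b n"
  unfolding A_seq_less_eq_iff(1)[OF assms(1,3)] sum_grid_Suc[OF assms(3)]
    sum_outer_weights[symmetric]
  using assms by (intro add_mono order_refl sum_mono convex_on_grid_point_Suc) auto

lemma A_seq_Suc_less:
  assumes "a < b" and "strictly_convex_on {a..b} f" and "0 < n"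
  shows "A_seq f a b (Suc n) < A_seq f a b n"
  unfolding A_seq_less_eq_iff(2)[OF assms(1,3)] sum_grid_Suc[OF assms(3)]
    \<comment> \<open>The equal endpoint terms are cancelled first, since
      \<open>sum_strict_mono\<close> needs strictness in every term of a nonempty sum.\<close>
    sum_outer_weights[symmetric] add_less_cancel_left add_less_cancel_right
  using assms by (intro sum_strict_mono strictly_convex_on_grid_point_Suc) auto

lemma B_seq_le_Suc:
  assumes "a < b" and "convex_on {a..b} f" and "0 < n"
  shows "B_seq f a b (Suc n) \<le> B_seq f a b (Suc (Suc n))"
  unfolding B_seq_less_eq_iff(1)[OF assms(1,3)] sum_inner_weights[symmetric]
  using assms by (intro sum_mono convex_on_grid_point) auto

lemma B_seq_less_Suc:
  assumes "a < b" and "strictly_convex_on {a..b} f" and "0 < n"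
  shows "B_seq f a b (Suc n) < B_seq f a b (Suc (Suc n))"
  unfolding B_seq_less_eq_iff(2)[OF assms(1,3)] sum_inner_weights[symmetric]
  using assms by (intro sum_strict_mono strictly_convex_on_grid_point) auto

theorem corollary2p3:
  fixes a b :: real and f :: "real \<Rightarrow> real"
  assumes "a < b" and "convex_on {a..b} f"
  shows "(\<forall>n\<ge>1. A_seq f a b (n + 1) \<le> A_seq f a b n) \<and>
         (\<forall>n\<ge>2. B_seq f a b n \<le> B_seq f a b (n + 1)) \<and>
         (strictly_convex_on {a..b} f \<longrightarrow>
            (\<forall>n\<ge>1. A_seq f a b (n + 1) < A_seq f a b n) \<and>
            (\<forall>n\<ge>2. B_seq f a b n < B_seq f a b (n + 1)))"
proof (intro conjI allI impI)
  fix n :: nat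
  assume "1 \<le> n"
  then show "A_seq f a b (n + 1) \<le> A_seq f a b n"
    using A_seq_Suc_le[OF assms, of n] by simp
next
  fix n :: nat
  assume "2 \<le> n"
  then show "B_seq f a b n \<le> B_seq f a b (n + 1)"
    \<comment> \<open>The shifted index \<open>n - 1\<close> is positive because
      \<open>2 \<le> n\<close>.\<close>
    using B_seq_le_Suc[OF assms, of "n - 1"] by simp
next
  fix n :: nat
  assume "strictly_convex_on {a..b} f" and "1 \<le> n"
  then show "A_seq f a b (n + 1) < A_seq f a b n"
    using A_seq_Suc_less[OF assms(1), of f n] by simp
next
  fix n :: nat
  assume "strictly_convex_on {a..b} f" and "2 \<le> n"
  then show "B_seq f a b n < B_seq f a b (n + 1)"
    using B_seq_less_Suc[OF assms(1), of f "n - 1"] by simp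
qed

end
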